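(* Let $n,m\geq 9$ be integers. Let $a$ be the largest integer with $a\le n$ and $a\equiv 2\pmod 7$, and $b$ the largest integer with $b\le m$ and $b\equiv 2\pmod 7$ (so $0\le n-a\le 6$, $0\le m-b\le 6$). Define $\alpha=0$ if $m\bmod 7=2$, $\alpha=1$ if $m\bmod 7\in\{3,4\}$, $\alpha=2$ if $m\bmod 7\in\{5,6\}$, $\alpha=3$ if $m\bmod 7\in\{0,1\}$; and define $\beta$ in the same way with $n$ in place of $m$. Then $$\gamma^{\infty}_{all}(P_m\boxtimes P_n)\leq \frac{ab}{7}+\frac{8}{7}(a+b-1)+\alpha\left\lceil\frac{n}{2}\right\rceil+\beta\left\lceil\frac{m}{2}\right\rceil-\alpha\beta.$$
   Context: $P_m\boxtimes P_n$ is the strong grid: vertex set $\{0,\dots,m-1\}\times\{0,\dots,n-1\}$, with $(i_1,j_1)$ adjacent to $(i_2,j_2)$ iff $\max\{|i_1-i_2|,|j_1-j_2|\}=1$. Eternal domination game (all-guards-move model): $k$ guards are placed on distinct vertices of a graph $G$ forming a dominating set; at each turn an attacker chooses a vertex, and then every guard may stay in place or move to an adjacent vertex, with no two guards ending on the same vertex, and some guard must end on the attacked vertex. $\gamma^{\infty}_{all}(G)$ is the minimum $k$ such that $k$ guards have a strategy to do this against every infinite sequence of attacks. *)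

theory Defs
  imports Complex_Main
begin

definition grid_V :: "nat \<Rightarrow> nat \<Rightarrow> (nat \<times> nat) set" where
  "grid_V m n = {0..<m} \<times> {0..<n}"

definition strong_adj :: "nat \<times> nat \<Rightarrow> nat \<times> nat \<Rightarrow> bool" where
  "strong_adj u v \<longleftrightarrow>
     max (nat \<bar>int (fst u) - int (fst v)\<bar>) (nat \<bar>int (snd u) - int (snd v)\<bar>) = 1"

definition dominating :: "'a set \<Rightarrow> ('a \<Rightarrow> 'a \<Rightarrow> bool) \<Rightarrow> 'a set \<Rightarrow> bool" where
  "dominating V adj D \<longleftrightarrow> D \<subseteq> V \<and> (\<forall>v\<in>V. v \<in> D \<or> (\<exists>u\<in>D. adj u v))"

definition guard_move :: "('a \<Rightarrow> 'a \<Rightarrow> bool) \<Rightarrow> 'a set \<Rightarrow> 'a set \<Rightarrow> bool" where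
  "guard_move adj D D' \<longleftrightarrow> (\<exists>f. bij_betw f D D' \<and> (\<forall>x\<in>D. f x = x \<or> adj x (f x)))"

text \<open>k guards can eternally defend (all-guards-move model): there is a nonempty family of
  k-guard configurations (dominating sets of size k) such that from every configuration in the
  family, for every attacked vertex, the guards can move to a configuration of the family that
  has a guard on the attacked vertex. (Standard eternal dominating family characterisation of a
  winning strategy against every infinite attack sequence.)\<close>
definition eternal_dom_all :: "'a set \<Rightarrow> ('a \<Rightarrow> 'a \<Rightarrow> bool) \<Rightarrow> nat \<Rightarrow> bool" where
  "eternal_dom_all V adj k \<longleftrightarrow>
     (\<exists>\<F>. \<F> \<noteq> {} \<and>
        (\<forall>D\<in>\<F>. finite D \<and> card D = k \<and> dominating V adj D) \<and>
        (\<forall>D\<in>\<F>. \<forall>v\<in>V. \<exists>D'\<in>\<F>. v \<in> D' \<and> guard_move adj D D'))"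

definition eternal_dom_all_number :: "'a set \<Rightarrow> ('a \<Rightarrow> 'a \<Rightarrow> bool) \<Rightarrow> nat" where
  "eternal_dom_all_number V adj = (LEAST k. eternal_dom_all V adj k)"

end

theory Submission
  imports Defs
begin

text \<open>
  Write \<open>b = 7p + 2\<close> and \<open>a = 7q + 2\<close>. What lies outside a \<open>b\<close> by \<open>a\<close> corner of the grid is covered by
  2 by 2 blocks aligned with the opposite corner, and one guard per clique suffices.

  In the \<open>b\<close> by \<open>a\<close> grid the interior guards occupy a lattice \<open>x + 2y \<equiv> t (mod 7)\<close>, or one of the
  mirrored lattices obtained from \<open>y \<mapsto> 7q + 1 - y\<close>. A lattice and a mirrored lattice meet in one
  point modulo 7, and around it there is a 7-periodic matching of the one with the other by king
  moves without net flow. Every vertex lies in a mirrored lattice, so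
  the guards answer any attack by passing to the opposite family. The perimeter has guards on its
  corners and on five of every seven other vertices, among them those of the lattice; at every
  perimeter segment of length 7 as many guards enter the interior as leave it, so it
  suffices to shift perimeter guards by at most one step. As everything is periodic, the existence
  of these shifts is a finite check on the 9 by 9 grid.
\<close>

subsection \<open>Eternal domination in general graphs\<close>

text \<open>Moves are constructed only from the lattice family to the mirrored one; inverting them
  gives the way back.\<close>

lemma guard_move_sym:
  assumes "\<And>x y. adj x y \<Longrightarrow> adj y x" and "guard_move adj D D'"
  shows "guard_move adj D' D"
proof -
  obtain f where f: "bij_betw f D D'" "\<forall>x\<in>D. f x = x \<or> adj x (f x)"
    using assms(2) by (auto simp: guard_move_def)
  have "\<forall>y\<in>D'. inv_into D f y = y \<or> adj y (inv_into D f y)"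
  proof
    fix y assume "y \<in> D'"
    with f(1) have "inv_into D f y \<in> D" "f (inv_into D f y) = y"
      by (auto simp: bij_betw_def inv_into_into f_inv_into_f)
    with f(2) show "inv_into D f y = y \<or> adj y (inv_into D f y)"
      using assms(1) by metis
  qed
  with bij_betw_inv_into[OF f(1)] show ?thesis
    unfolding guard_move_def by blast
qed

text \<open>Domination is automatic: the guard that answers an attack on \<open>v\<close> comes from \<open>v\<close> or
  from a neighbour of \<open>v\<close>.\<close>
lemma eternal_dom_allI:
  assumes "\<F> \<noteq> {}"
    and "\<And>D. D \<in> \<F> \<Longrightarrow> D \<subseteq> V \<and> finite D \<and> card D = k"
    and step: "\<And>D v. D \<in> \<F> \<Longrightarrow> v \<in> V \<Longrightarrow> \<exists>D'\<in>\<F>. v \<in> D' \<and> guard_move adj D D'"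
  shows "eternal_dom_all V adj k"
proof -
  have "dominating V adj D" if D: "D \<in> \<F>" for D
    unfolding dominating_def
  proof (intro conjI ballI)
    show "D \<subseteq> V" using assms(2) D by blast
    fix v assume "v \<in> V"
    then obtain D' f where "v \<in> D'" "bij_betw f D D'" "\<forall>x\<in>D. f x = x \<or> adj x (f x)"
      using step[OF D] unfolding guard_move_def by blast
    then show "v \<in> D \<or> (\<exists>u\<in>D. adj u v)"
      by (auto simp: bij_betw_def)
  qed
  with assms show ?thesis
    unfolding eternal_dom_all_def by (intro exI[of _ \<F>]) auto
qed

lemma eternal_dom_allE:
  assumes "eternal_dom_all V adj k"
  obtains \<F> where "\<F> \<noteq> {}" "\<And>D. D \<in> \<F> \<Longrightarrow> D \<subseteq> V \<and> finite D \<and> card D = k"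
    "\<And>D v. D \<in> \<F> \<Longrightarrow> v \<in> V \<Longrightarrow> \<exists>D'\<in>\<F>. v \<in> D' \<and> guard_move adj D D'"
proof -
  from assms obtain \<F> where "\<F> \<noteq> {}"
    and F: "\<forall>D\<in>\<F>. finite D \<and> card D = k \<and> dominating V adj D"
      "\<forall>D\<in>\<F>. \<forall>v\<in>V. \<exists>D'\<in>\<F>. v \<in> D' \<and> guard_move adj D D'"
    unfolding eternal_dom_all_def by (elim exE conjE)
  then show thesis by (intro that[of \<F>]) (auto simp: dominating_def)
qed

lemma guard_move_refl: "guard_move adj D D"
  unfolding guard_move_def by (intro exI[of _ id]) auto

lemma guard_move_Un:
  assumes "guard_move adj D D'" "guard_move adj E E'" "D \<inter> E = {}" "D' \<inter> E' = {}"
  shows "guard_move adj (D \<union> E) (D' \<union> E')"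
proof -
  obtain f g where f: "bij_betw f D D'" "\<forall>x\<in>D. f x = x \<or> adj x (f x)"
    and g: "bij_betw g E E'" "\<forall>x\<in>E. g x = x \<or> adj x (g x)"
    using assms(1,2) by (auto simp: guard_move_def)
  define h where "h x = (if x \<in> D then f x else g x)" for x
  have "bij_betw h D D'"
    using f(1) by (rule bij_betw_cong[THEN iffD1, rotated]) (simp add: h_def)
  moreover have "bij_betw h E E'"
    using g(1) assms(3) by (subst bij_betw_cong[of _ _ g]) (auto simp: h_def)
  ultimately have "bij_betw h (D \<union> E) (D' \<union> E')"
    using assms(4) by (rule bij_betw_combine)
  moreover have "\<forall>x\<in>D \<union> E. h x = x \<or> adj x (h x)"
    using f(2) g(2) by (auto simp: h_def)
  ultimately show ?thesis unfolding guard_move_def by blast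
qed

text \<open>The part that contains the attacked vertex answers, the other part stands still.\<close>

lemma eternal_dom_all_Un:
  assumes "eternal_dom_all V adj k" "eternal_dom_all W adj l" "V \<inter> W = {}"
  shows "eternal_dom_all (V \<union> W) adj (k + l)"
proof -
  obtain \<F> where F: "\<F> \<noteq> {}" "\<And>D. D \<in> \<F> \<Longrightarrow> D \<subseteq> V \<and> finite D \<and> card D = k"
    "\<And>D v. D \<in> \<F> \<Longrightarrow> v \<in> V \<Longrightarrow> \<exists>D'\<in>\<F>. v \<in> D' \<and> guard_move adj D D'"
    using assms(1) by (rule eternal_dom_allE) blast
  obtain \<G> where G: "\<G> \<noteq> {}" "\<And>D. D \<in> \<G> \<Longrightarrow> D \<subseteq> W \<and> finite D \<and> card D = l"
    "\<And>D v. D \<in> \<G> \<Longrightarrow> v \<in> W \<Longrightarrow> \<exists>D'\<in>\<G>. v \<in> D' \<and> guard_move adj D D'"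
    using assms(2) by (rule eternal_dom_allE) blast
  have disj: "D \<inter> E = {}" if "D \<in> \<F>" "E \<in> \<G>" for D E
    using F(2)[OF that(1)] G(2)[OF that(2)] assms(3) by blast
  show ?thesis
  proof (rule eternal_dom_allI[where \<F> = "{D \<union> E | D E. D \<in> \<F> \<and> E \<in> \<G>}"])
    show "{D \<union> E | D E. D \<in> \<F> \<and> E \<in> \<G>} \<noteq> {}" using F(1) G(1) by blast
  next
    fix X assume "X \<in> {D \<union> E | D E. D \<in> \<F> \<and> E \<in> \<G>}"
    then obtain D E where DE: "X = D \<union> E" "D \<in> \<F>" "E \<in> \<G>" by blast
    then show "X \<subseteq> V \<union> W \<and> finite X \<and> card X = k + l"
      using F(2)[OF DE(2)] G(2)[OF DE(3)] disj[OF DE(2,3)] by (auto simp: card_Un_disjoint)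
  next
    fix X v assume "X \<in> {D \<union> E | D E. D \<in> \<F> \<and> E \<in> \<G>}" and v: "v \<in> V \<union> W"
    then obtain D E where DE: "X = D \<union> E" "D \<in> \<F>" "E \<in> \<G>" by blast
    have "\<exists>D'\<in>\<F>. \<exists>E'\<in>\<G>. v \<in> D' \<union> E' \<and> guard_move adj D D' \<and> guard_move adj E E'"
    proof (cases "v \<in> V")
      case True
      with F(3)[OF DE(2)] obtain D' where "D' \<in> \<F>" "v \<in> D'" "guard_move adj D D'" by blast
      with DE(3) guard_move_refl show ?thesis by blast
    next
      case False
      with v G(3)[OF DE(3)] obtain E' where "E' \<in> \<G>" "v \<in> E'" "guard_move adj E E'" by blast
      with DE(2) guard_move_refl show ?thesis by blast
    qed
    then obtain D' E' where D'E': "D' \<in> \<F>" "E' \<in> \<G>" "v \<in> D' \<union> E'"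
      and "guard_move adj D D'" "guard_move adj E E'" by blast
    then have "guard_move adj X (D' \<union> E')"
      unfolding DE(1) by (intro guard_move_Un disj DE(2,3))
    with D'E' show "\<exists>X'\<in>{D \<union> E | D E. D \<in> \<F> \<and> E \<in> \<G>}. v \<in> X' \<and> guard_move adj X X'"
      by blast
  qed
qed

text \<open>Each nonempty fibre of \<open>c\<close> in \<open>V\<close> is a clique and keeps
  exactly one guard, which can reach any attacked vertex of its fibre in one move.\<close>

lemma eternal_dom_all_clique_partition:
  assumes "finite V"
    and clique: "\<And>u v. u \<in> V \<Longrightarrow> v \<in> V \<Longrightarrow> c u = c v \<Longrightarrow> u \<noteq> v \<Longrightarrow> adj u v"
  shows "eternal_dom_all V adj (card (c ` V))"
proof (rule eternal_dom_allI[where \<F> = "{D. D \<subseteq> V \<and> bij_betw c D (c ` V)}"])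
  have "\<exists>D\<subseteq>V. inj_on c D \<and> c ` V = c ` D"
    using subset_image_inj[of "c ` V" c V] by (simp only: subset_refl simp_thms)
  then obtain D where "D \<subseteq> V" "inj_on c D" "c ` V = c ` D" by blast
  then have "D \<in> {D. D \<subseteq> V \<and> bij_betw c D (c ` V)}"
    by (simp add: bij_betw_def)
  then show "{D. D \<subseteq> V \<and> bij_betw c D (c ` V)} \<noteq> {}" by blast
next
  fix D assume "D \<in> {D. D \<subseteq> V \<and> bij_betw c D (c ` V)}"
  then show "D \<subseteq> V \<and> finite D \<and> card D = card (c ` V)"
    using assms(1) by (auto simp: finite_subset dest: bij_betw_same_card)
next
  fix D v assume "D \<in> {D. D \<subseteq> V \<and> bij_betw c D (c ` V)}" and v: "v \<in> V"
  then have D: "D \<subseteq> V" "inj_on c D" "c ` D = c ` V" by (auto simp: bij_betw_def)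
  define f where "f x = (if c x = c v then v else x)" for x
  have cf: "c (f x) = c x" for x by (simp add: f_def)
  have inj: "inj_on f D" by (rule inj_onI) (metis D(2) cf inj_onD)
  have "inj_on c (f ` D)" using D(2) by (intro inj_onI) (auto simp: cf dest: inj_onD)
  moreover have "c ` f ` D = c ` V" using D(3) by (simp add: image_image cf)
  moreover have "f ` D \<subseteq> V" using D(1) v by (auto simp: f_def)
  moreover have "v \<in> f ` D"
  proof -
    obtain x where "x \<in> D" "c x = c v" using D(3) v by (metis imageE imageI)
    then show ?thesis by (force simp: f_def)
  qed
  moreover have "guard_move adj D (f ` D)"
    unfolding guard_move_def
  proof (intro exI[of _ f] conjI ballI)
    show "bij_betw f D (f ` D)" using inj by (simp add: bij_betw_def)
    fix x assume "x \<in> D"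
    then show "f x = x \<or> adj x (f x)"
      using clique[of x v] D(1) v by (auto simp: f_def)
  qed
  ultimately show "\<exists>D'\<in>{D. D \<subseteq> V \<and> bij_betw c D (c ` V)}. v \<in> D' \<and> guard_move adj D D'"
    unfolding bij_betw_def by blast
qed

subsection \<open>Guard positions and moves modulo 7\<close>

datatype dir = Dn | St | Up

primrec opp :: "dir \<Rightarrow> dir" where
  "opp Dn = Up" | "opp St = St" | "opp Up = Dn"

text \<open>A coordinate in \<open>{0..7p+1}\<close> is represented by \<open>0\<close> or \<open>8\<close> if it is extremal and otherwise by
  its residue modulo 7 in \<open>{1..7}\<close>. Entry \<open>t\<close> of the following tables, found by computer search,
  contains the residues of the unguarded vertices on the right and on the top side; the left and
  the bottom side result from rotation by 180 degrees, which turns lattice \<open>t\<close> into \<open>3 - t\<close>.\<close>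

definition side_holes :: "nat list list" where
  "side_holes = [[0,1], [1,5], [1,5], [3,6], [2,6], [3,6], [1,5]]"
definition top_holes :: "nat list list" where
  "top_holes = [[0,3], [1,4], [2,5], [3,6], [0,3], [2,6], [2,6]]"

text \<open>For \<open>t < 7\<close>, \<open>(10 - t) mod 7\<close> is \<open>3 - t\<close> modulo 7
  without truncated subtraction.\<close>

fun occ :: "nat \<Rightarrow> nat \<times> nat \<Rightarrow> bool" where
  "occ t (x, y) =
     (if x \<in> {0, 8} then y \<in> {0, 8} \<or>
        (if x = 8 then y mod 7 \<notin> set (side_holes ! t)
         else (8 - y) mod 7 \<notin> set (side_holes ! ((10 - t) mod 7)))
      else if y = 8 then x mod 7 \<notin> set (top_holes ! t)
      else if y = 0 then (8 - x) mod 7 \<notin> set (top_holes ! ((10 - t) mod 7))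
      else (x + 2 * y) mod 7 = t)"

declare occ.simps [simp del]

text \<open>The move of the lattice guard in row \<open>y\<close> on passing from lattice \<open>t\<close> to the mirror of
  lattice \<open>u\<close>: these meet (mod 7) in the row \<open>2t - 2u + 4\<close>, where the guard stays.\<close>

definition drift :: "nat \<Rightarrow> nat \<Rightarrow> nat \<Rightarrow> dir \<times> dir" where
  "drift t u y = [(St,St), (Dn,Up), (Dn,Dn), (St,Up), (St,Dn), (Up,Up), (Up,Dn)]
     ! ((y + 5 * t + 2 * u + 3) mod 7)"

text \<open>A perimeter guard on the lattice joins the interior matching if its drift leads inward
  from every side it lies on; otherwise \<open>perimeter_moves\<close> decides its move.\<close>

fun enters :: "nat \<Rightarrow> nat \<Rightarrow> nat \<times> nat \<Rightarrow> bool" where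
  "enters t u (x, y) =
     (if (x + 2 * y) mod 7 = t then
     (case drift t u y of (d, e) \<Rightarrow>
        (x = 0 \<longrightarrow> d = Up) \<and> (x = 8 \<longrightarrow> d = Dn) \<and> (y = 0 \<longrightarrow> e = Up) \<and> (y = 8 \<longrightarrow> e = Dn)) else False)"

definition perimeter :: "((nat \<times> nat) \<times> (dir \<times> dir)) list" where
  "perimeter = map (\<lambda>i. ((i, 0), (Up, St))) [0..<8] @ map (\<lambda>i. ((8, i), (St, Up))) [0..<8]
        @ map (\<lambda>i. ((8 - i, 8), (Dn, St))) [0..<8] @ map (\<lambda>i. ((0, 8 - i), (St, Dn))) [0..<8]"

text \<open>The reverse of the transition from \<open>t\<close> to the mirror of \<open>u\<close> is the mirror of the transition from
  \<open>u\<close> to the mirror of \<open>t\<close>. So the second summand counts the guard that \<open>(x, y)\<close> needs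
  unless one arrives from the interior.\<close>

fun net :: "nat \<Rightarrow> nat \<Rightarrow> nat \<times> nat \<Rightarrow> int" where
  "net t u (x, y) = (if occ t (x, y) then if enters t u (x, y) then 0 else 1 else 0)
     - (if occ u (x, 8 - y) then if enters u t (x, 8 - y) then 0 else 1 else 0)"

text \<open>\<open>f\<close> is the number of guards passing from the preceding perimeter vertex to the
  current one and \<open>b\<close> the direction leading back there.\<close>

fun perimeter_moves :: "nat \<Rightarrow> nat \<Rightarrow> int \<Rightarrow> dir \<times> dir \<Rightarrow> ((nat \<times> nat) \<times> (dir \<times> dir)) list
    \<Rightarrow> ((nat \<times> nat) \<times> (dir \<times> dir)) list" where
  "perimeter_moves t u f b [] = []"
| "perimeter_moves t u f b ((z, d) # zs) =
     (let g = f + net t u z;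
          r = perimeter_moves t u g (opp (fst d), opp (snd d)) zs in
      if occ t z then (z, if enters t u z then drift t u (snd z)
                  else if g = 1 then d else if f = -1 then b else (St, St)) # r else r)"

definition inner :: "(nat \<times> nat) list" where
  "inner = List.product [1..<8] [1..<8]"

text \<open>The initial flow 1 belongs to the two transitions in which a corner loses its guard to the
  interior, the opposite corner receives one from there, and the replacement travels along
  the left side.\<close>

definition moves :: "nat \<Rightarrow> nat \<Rightarrow> ((nat \<times> nat) \<times> (dir \<times> dir)) list" where
  "moves t u =
     perimeter_moves t u (if (t, u) \<in> {(0, 1), (1, 0)} then 1 else 0) (St, Up) perimeter
     @ map (\<lambda>z. (z, drift t u (snd z))) (filter (occ t) inner)"

text \<open>The neighbour of a coordinate with residue 7 is either extremal or has residue 1.\<close>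

fun steps :: "dir \<Rightarrow> nat \<Rightarrow> nat list" where
  "steps St x = [x]"
| "steps Up x = (if x = 8 then [] else if x = 7 then [1, 8] else [Suc x])"
| "steps Dn x = (if x = 0 then [] else if x = 1 then [0, 7] else [x - 1])"

text \<open>All targets offered by \<open>steps\<close> are tested, as classes do not determine
  which one occurs. Reversal and mirroring both flip the vertical direction, so \<open>e\<close> is
  kept.\<close>

fun undoes :: "((nat \<times> nat) \<times> (dir \<times> dir)) list \<Rightarrow> (nat \<times> nat) \<times> (dir \<times> dir) \<Rightarrow> bool" where
  "undoes B ((x, y), (d, e)) \<longleftrightarrow> steps d x \<noteq> [] \<and> steps e y \<noteq> [] \<and>
     list_all (List.member B)
       (map (\<lambda>(x', y'). ((x', 8 - y'), (opp d, e))) (List.product (steps d x) (steps e y)))"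

definition consistent :: "nat \<Rightarrow> nat \<Rightarrow> bool" where
  "consistent t u = list_all (undoes (moves u t)) (moves t u)"

definition consistent_from :: "nat \<Rightarrow> bool" where
  "consistent_from t = list_all (consistent t) [0..<7]"

text \<open>These 49 checks make the moves for \<open>t, u\<close> and for \<open>u, t\<close>
  mutually inverse up to mirroring, independently of the grid size.\<close>

lemma all_consistent: "list_all consistent_from [0..<7]"
  by code_simp

subsection \<open>Lifting the tables to large grids\<close>

lemma strong_adj_iff:
  "strong_adj (x, y) (x', y') \<longleftrightarrow>
     (x, y) \<noteq> (x', y') \<and> x \<le> Suc x' \<and> x' \<le> Suc x \<and> y \<le> Suc y' \<and> y' \<le> Suc y"
  unfolding strong_adj_def by (auto simp: max_def)

lemma strong_adj_sym: "strong_adj u v \<Longrightarrow> strong_adj v u"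
  by (cases u; cases v) (auto simp: strong_adj_iff)

definition cls :: "nat \<Rightarrow> nat \<Rightarrow> nat" where
  "cls p x = (if x = 0 then 0 else if x = 7 * p + 1 then 8 else Suc ((x - 1) mod 7))"

primrec shift :: "dir \<Rightarrow> nat \<Rightarrow> nat" where
  "shift Dn x = x - 1" | "shift St x = x" | "shift Up x = Suc x"

lemma cls_le: "cls p x \<le> 8"
  using mod_less_divisor[of 7 "x - 1"] by (auto simp: cls_def)

lemma cls_eq_0_iff: "cls p x = 0 \<longleftrightarrow> x = 0"
  by (auto simp: cls_def)

lemma cls_eq_8_iff: "cls p x = 8 \<longleftrightarrow> x = 7 * p + 1"
  using mod_less_divisor[of 7 "x - 1"] by (auto simp: cls_def)

text \<open>Modulo 7, \<open>7 * p + 1 - x\<close> is \<open>8 - x\<close>, and the ends are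
  exchanged. So \<open>mirror\<close> acts on the tables as \<open>8 - y\<close>.\<close>

lemma cls_mirror:
  assumes "p \<ge> 1" "x \<le> 7 * p + 1"
  shows "cls p (7 * p + 1 - x) = 8 - cls p x"
proof (cases "x = 0 \<or> x = 7 * p + 1")
  case False
  define k r where "k = (x - 1) div 7" and "r = (x - Suc 0) mod 7"
  have kr: "x = 7 * k + r + 1" "r \<le> 6"
    using False div_mult_mod_eq[of "x - 1" 7] by (auto simp: k_def r_def)
  then have "7 * p - x = (6 - r) + (p - k - 1) * 7" using False assms by auto
  then have "(7 * p - x) mod 7 = (6 - r) mod 7" by (metis mod_mult_self1)
  then have "(7 * p - x) mod 7 = 6 - r" by simp
  with False assms kr(2) show ?thesis by (auto simp: cls_def r_def[symmetric])
qed (auto simp: cls_def)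

text \<open>Nonempty \<open>steps\<close> exclude moves off the grid, so the truncated subtraction
  in \<open>shift\<close> is harmless.\<close>

lemma shift_cls:
  assumes "p \<ge> 1" "x \<le> 7 * p + 1" "steps d (cls p x) \<noteq> []"
  shows "shift d x \<le> 7 * p + 1" "cls p (shift d x) \<in> set (steps d (cls p x))"
    "shift (opp d) (shift d x) = x" "x \<le> Suc (shift d x)" "shift d x \<le> Suc x"
proof -
  \<comment> \<open>Hence \<open>7 * p\<close>, the neighbour of the far end, has class 7.\<close>
  have "7 * p - Suc 0 = 6 + (p - 1) * 7" using \<open>p \<ge> 1\<close> by simp
  then have last: "(7 * p - Suc 0) mod 7 = 6" by simp
  have "shift d x \<le> 7 * p + 1 \<and> cls p (shift d x) \<in> set (steps d (cls p x)) \<and>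
    shift (opp d) (shift d x) = x \<and> x \<le> Suc (shift d x) \<and> shift d x \<le> Suc x"
  proof (cases d)
    case Dn
    with assms have "x \<noteq> 0" by (auto simp: cls_eq_0_iff split: if_splits)
    moreover have "cls p (x - 1) \<in> set (steps Dn (cls p x))"
    proof (cases "x = 1 \<or> x = 7 * p + 1")
      case False
      with \<open>x \<noteq> 0\<close> have "x - 1 = Suc (x - 2)" by linarith
      then have "(x - 1) mod 7 = (if (x - 2) mod 7 = 6 then 0 else Suc ((x - 2) mod 7))"
        by (simp add: mod_Suc)
      with False \<open>x \<noteq> 0\<close> assms(2) show ?thesis
        by (auto simp: cls_def numeral_2_eq_2 split: if_splits)
    qed (use \<open>p \<ge> 1\<close> last in \<open>auto simp: cls_def\<close>)
    ultimately show ?thesis using Dn assms by auto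
  next
    case Up
    with assms have "x \<noteq> 7 * p + 1" by (auto simp: cls_eq_8_iff split: if_splits)
    moreover have "cls p (Suc x) \<in> set (steps Up (cls p x))"
    proof (cases "x = 0 \<or> x = 7 * p")
      case False
      then have "x mod 7 = (if (x - 1) mod 7 = 6 then 0 else Suc ((x - 1) mod 7))"
        using mod_Suc[of "x - 1" 7] by simp
      with False \<open>x \<noteq> 7 * p + 1\<close> show ?thesis by (auto simp: cls_def)
    qed (use \<open>p \<ge> 1\<close> last in \<open>auto simp: cls_def\<close>)
    ultimately show ?thesis using Up assms by auto
  qed (use assms in auto)
  then show "shift d x \<le> 7 * p + 1" "cls p (shift d x) \<in> set (steps d (cls p x))"
    "shift (opp d) (shift d x) = x" "x \<le> Suc (shift d x)" "shift d x \<le> Suc x"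
    by auto
qed

lemma card_cls:
  assumes "c \<le> 8"
  shows "card {x. x \<le> 7 * p + 1 \<and> cls p x = c} = (if c \<in> {0, 8} then 1 else p)"
proof -
  consider "c = 0" | "c = 8" | "1 \<le> c" "c \<le> 7" using assms by linarith
  then show ?thesis
  proof cases
    case 1
    then have "{x. x \<le> 7 * p + 1 \<and> cls p x = c} = {0}" by (auto simp: cls_eq_0_iff)
    with 1 show ?thesis by simp
  next
    case 2
    then have "{x. x \<le> 7 * p + 1 \<and> cls p x = c} = {7 * p + 1}" by (auto simp: cls_eq_8_iff)
    with 2 show ?thesis by simp
  next
    case 3
    have "{x. x \<le> 7 * p + 1 \<and> cls p x = c} = (\<lambda>i. 7 * i + c) ` {..<p}" (is "?A = ?B")
    proof (intro subset_antisym subsetI)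
      fix x assume "x \<in> ?A"
      with 3 have x: "x \<noteq> 0" "x \<noteq> 7 * p + 1" "x \<le> 7 * p + 1" "Suc ((x - 1) mod 7) = c"
        by (auto simp: cls_def split: if_splits)
      with div_mult_mod_eq[of "x - 1" 7]
      have "x = 7 * ((x - 1) div 7) + c" by linarith
      moreover from this x 3 have "(x - 1) div 7 < p" by linarith
      ultimately show "x \<in> ?B" by blast
    next
      fix x assume "x \<in> ?B"
      then obtain i where i: "i < p" "x = 7 * i + c" by blast
      with 3 have "x - 1 = (c - 1) + i * 7" by simp
      then have "(x - 1) mod 7 = (c - 1) mod 7" by (metis mod_mult_self1)
      with 3 have "Suc ((x - 1) mod 7) = c" by simp
      with i 3 show "x \<in> ?A" by (auto simp: cls_def)
    qed
    moreover have "inj_on (\<lambda>i. 7 * i + c) {..<p}" by (auto simp: inj_on_def)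
    ultimately show ?thesis using 3 by (simp add: card_image)
  qed
qed

lemma consistentD: "t < 7 \<Longrightarrow> u < 7 \<Longrightarrow> consistent t u"
  using all_consistent by (auto simp: list_all_iff consistent_from_def)

lemma map_fst_perimeter_moves:
  "map fst (perimeter_moves t u f b zs) = filter (occ t) (map fst zs)"
  by (induction zs arbitrary: f b) (auto simp: Let_def)

lemma map_fst_moves: "map fst (moves t u) = filter (occ t) (map fst perimeter @ inner)"
  by (simp add: moves_def map_fst_perimeter_moves comp_def)

lemma distinct_cells: "distinct (map fst perimeter @ inner)"
  by code_simp

lemma set_cells: "set (map fst perimeter @ inner) = {..8} \<times> {..8}"
proof -
  have "set (map fst perimeter @ inner) = set (List.product [0..<9] [0..<9])"
    by code_simp
  moreover have "{0..<9} = {..8::nat}" by auto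
  ultimately show ?thesis by simp
qed

lemma map_of_moves:
  assumes "(z, m) \<in> set (moves t u)"
  shows "map_of (moves t u) z = Some m"
proof -
  have "distinct (map fst (moves t u))"
    unfolding map_fst_moves using distinct_cells by (rule distinct_filter)
  with assms show ?thesis by simp
qed

lemma ex_move:
  assumes "occ t (c, c')" "c \<le> 8" "c' \<le> 8"
  obtains d e where "((c, c'), (d, e)) \<in> set (moves t u)"
proof -
  have "(c, c') \<in> set (map fst (moves t u))"
    unfolding map_fst_moves using assms set_cells by auto
  then show thesis using that by auto
qed

section \<open>Configurations and responses on the large grid\<close>

definition config :: "nat \<Rightarrow> nat \<Rightarrow> nat \<Rightarrow> (nat \<times> nat) set" where
  "config p q t = {(x, y). x \<le> 7 * p + 1 \<and> y \<le> 7 * q + 1 \<and> occ t (cls p x, cls q y)}"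

definition mirror :: "nat \<Rightarrow> nat \<times> nat \<Rightarrow> nat \<times> nat" where
  "mirror q z = (fst z, 7 * q + 1 - snd z)"

fun respond :: "nat \<Rightarrow> nat \<Rightarrow> nat \<Rightarrow> nat \<Rightarrow> nat \<times> nat \<Rightarrow> nat \<times> nat" where
  "respond p q t u (x, y) =
     (case the (map_of (moves t u) (cls p x, cls q y)) of (d, e) \<Rightarrow> (shift d x, shift e y))"

lemma respond:
  assumes "p \<ge> 1" "q \<ge> 1" "t < 7" "u < 7" "z \<in> config p q t"
  defines "w \<equiv> respond p q t u z"
  shows "w = z \<or> strong_adj z w" "snd w \<le> 7 * q + 1" "mirror q w \<in> config p q u"
    "mirror q (respond p q u t (mirror q w)) = z"
proof -
  obtain x y where z: "z = (x, y)" "x \<le> 7 * p + 1" "y \<le> 7 * q + 1" "occ t (cls p x, cls q y)"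
    using assms(5) by (auto simp: config_def)
  obtain d e where de: "((cls p x, cls q y), (d, e)) \<in> set (moves t u)"
    using ex_move[OF z(4) cls_le cls_le] .
  then have w: "w = (shift d x, shift e y)"
    by (simp add: w_def z map_of_moves)
  from de consistentD[OF \<open>t < 7\<close> \<open>u < 7\<close>]
  have undo: "undoes (moves u t) ((cls p x, cls q y), (d, e))"
    unfolding consistent_def list_all_iff by blast
  then have ne: "steps d (cls p x) \<noteq> []" "steps e (cls q y) \<noteq> []" by auto
  note sx = shift_cls[OF \<open>p \<ge> 1\<close> z(2) ne(1)] and sy = shift_cls[OF \<open>q \<ge> 1\<close> z(3) ne(2)]
  show "w = z \<or> strong_adj z w"
    using sx(4,5) sy(4,5) by (auto simp: w z strong_adj_iff)
  show "snd w \<le> 7 * q + 1"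
    using sy(1) by (simp add: w)
  define y' where "y' = 7 * q + 1 - shift e y"
  have y': "y' \<le> 7 * q + 1" "cls q y' = 8 - cls q (shift e y)"
    using cls_mirror[OF \<open>q \<ge> 1\<close> sy(1)] by (auto simp: y'_def)
  have undone: "((cls p (shift d x), cls q y'), (opp d, e)) \<in> set (moves u t)"
    using undo sx(2) sy(2) unfolding y'(2) undoes.simps list_all_iff by fastforce
  have mw: "mirror q w = (shift d x, y')"
    by (simp add: mirror_def w y'_def)
  have "(cls p (shift d x), cls q y') \<in> set (map fst (moves u t))"
    using undone by force
  then have "occ u (cls p (shift d x), cls q y')"
    unfolding map_fst_moves by auto
  with sx(1) y'(1) show "mirror q w \<in> config p q u"
    unfolding mw config_def by blast
  \<comment> \<open>Applying \<open>e\<close> to the reflected row and reflecting again undoes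
    \<open>shift e\<close>.\<close>
  have "7 * q + 1 - shift e y' = y"
    using sy z(3) ne(2) cls_eq_0_iff[of q y]
    by (cases e) (auto simp: y'_def split: if_splits)
  then show "mirror q (respond p q u t (mirror q w)) = z"
    unfolding mw using sx(3) by (simp add: map_of_moves[OF undone] mirror_def z)
qed

lemma mirror_mirror: "snd z \<le> 7 * q + 1 \<Longrightarrow> mirror q (mirror q z) = z"
  by (simp add: mirror_def prod_eq_iff)

lemma config_subset: "config p q t \<subseteq> {0..<7 * p + 2} \<times> {0..<7 * q + 2}"
  by (auto simp: config_def)

lemma mirror_in_grid:
  "z \<in> {0..<7 * p + 2} \<times> {0..<7 * q + 2} \<Longrightarrow> mirror q z \<in> {0..<7 * p + 2} \<times> {0..<7 * q + 2}"
  by (auto simp: mirror_def)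

lemma finite_config: "finite (config p q t)"
  by (rule finite_subset[OF config_subset]) simp

lemma inj_on_mirror: "inj_on (mirror q) (config p q t)"
  by (rule inj_on_inverseI[of _ "mirror q"]) (auto simp: config_def mirror_mirror)

text \<open>The inverse is the same map with \<open>t\<close> and \<open>u\<close>
  exchanged.\<close>

lemma bij_betw_mirror_respond:
  assumes "p \<ge> 1" "q \<ge> 1" "t < 7" "u < 7"
  shows "bij_betw (mirror q \<circ> respond p q t u) (config p q t) (config p q u)"
  using respond[OF assms] respond[OF assms(1,2,4,3)]
  by (intro bij_betw_byWitness[where f' = "mirror q \<circ> respond p q u t"]) auto

lemma guard_move_config:
  assumes "p \<ge> 1" "q \<ge> 1" "t < 7" "u < 7"
  shows "guard_move strong_adj (config p q t) (mirror q ` config p q u)"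
  unfolding guard_move_def
proof (intro exI conjI ballI)
  have "bij_betw (mirror q \<circ> (mirror q \<circ> respond p q t u)) (config p q t) (mirror q ` config p q u)"
    by (rule bij_betw_trans[OF bij_betw_mirror_respond[OF assms] inj_on_imp_bij_betw[OF inj_on_mirror]])
  then show "bij_betw (respond p q t u) (config p q t) (mirror q ` config p q u)"
    by (rule bij_betw_cong[THEN iffD1, rotated])
      (use respond(2)[OF assms] mirror_mirror in \<open>auto simp del: respond.simps\<close>)
next
  fix z assume "z \<in> config p q t"
  then show "respond p q t u z = z \<or> strong_adj z (respond p q t u z)"
    using respond(1)[OF assms] by blast
qed

section \<open>Number of guards and covering\<close>

lemma card_config_0:
  "card (config p q 0) = 7 * p * q + 10 * p + 10 * q + 4"
proof -
  define L where "L = filter (occ 0) (map fst perimeter @ inner)"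
  define A where "A r c = {x. x \<le> 7 * r + 1 \<and> cls r x = c}" for r c
  have L: "set L = {z \<in> {..8} \<times> {..8}. occ 0 z}" "distinct L"
    using set_cells distinct_cells unfolding L_def by auto
  have "config p q 0 = (\<Union>z\<in>set L. A p (fst z) \<times> A q (snd z))"
    unfolding L config_def A_def using cls_le by auto
  also have "card \<dots> = (\<Sum>z\<in>set L. card (A p (fst z) \<times> A q (snd z)))"
    by (rule card_UN_disjoint) (auto simp: A_def)
  also have "\<dots> = (\<Sum>z\<in>set L. (if fst z \<in> {0, 8} then 1 else p) * (if snd z \<in> {0, 8} then 1 else q))"
    unfolding A_def card_cartesian_product
    by (intro sum.cong refl arg_cong2[where f = "(*)"] card_cls) (auto simp: L)
  also have "\<dots> = (\<Sum>z\<leftarrow>L. (if fst z \<in> {0, 8} then 1 else p) * (if snd z \<in> {0, 8} then 1 else q))"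
    using L(2) by (rule sum.distinct_set_conv_list)
  \<comment> \<open>Seven interior residue pairs, five residues on each of the four sides, and four
    corners.\<close>
  also have "\<dots> = 7 * p * q + 10 * p + 10 * q + 4"
    by (simp add: L_def occ.simps perimeter_def inner_def side_holes_def top_holes_def upt_rec)
  finally show ?thesis .
qed

text \<open>The transition to lattice 0 is a bijection, so counting that one suffices.\<close>

lemma card_config:
  assumes "p \<ge> 1" "q \<ge> 1" "t < 7"
  shows "card (config p q t) = 7 * p * q + 10 * p + 10 * q + 4"
  using bij_betw_same_card[OF bij_betw_mirror_respond[of p q t 0]] card_config_0 assms by simp

text \<open>In the interior \<open>t\<close> is determined by the lattice; on the perimeter the
  check says that no vertex is a hole for all seven \<open>t\<close>.\<close>

lemma config_cover:
  assumes "v \<in> {0..<7 * p + 2} \<times> {0..<7 * q + 2}"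
  obtains t where "t < 7" "v \<in> config p q t"
proof -
  have "list_all (\<lambda>z. list_ex (\<lambda>t. occ t z) [0..<7]) (map fst perimeter @ inner)"
    by code_simp
  moreover have "(cls p (fst v), cls q (snd v)) \<in> set (map fst perimeter @ inner)"
    unfolding set_cells using cls_le by simp
  ultimately obtain t where "t \<in> set [0..<7]" "occ t (cls p (fst v), cls q (snd v))"
    unfolding list_all_iff list_ex_iff by blast
  with assms show thesis
    by (intro that[of t]) (auto simp: config_def)
qed

lemma mirror_config_subset: "mirror q ` config p q t \<subseteq> {0..<7 * p + 2} \<times> {0..<7 * q + 2}"
  using config_subset mirror_in_grid by blast

lemma eternal_dom_all_core:
  assumes "p \<ge> 1" "q \<ge> 1"
  shows "eternal_dom_all ({0..<7 * p + 2} \<times> {0..<7 * q + 2}) strong_adj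
           (7 * p * q + 10 * p + 10 * q + 4)"
proof (rule eternal_dom_allI[where
      \<F> = "config p q ` {..<7} \<union> (\<lambda>t. mirror q ` config p q t) ` {..<7}"])
  fix D assume D: "D \<in> config p q ` {..<7} \<union> (\<lambda>t. mirror q ` config p q t) ` {..<7}"
  show "D \<subseteq> {0..<7 * p + 2} \<times> {0..<7 * q + 2} \<and> finite D \<and>
      card D = 7 * p * q + 10 * p + 10 * q + 4"
    using D
  proof (elim UnE imageE)
    fix t :: nat assume "D = config p q t" "t \<in> {..<7}"
    then show ?thesis
      using config_subset finite_config card_config assms by simp
  next
    fix t :: nat assume "D = mirror q ` config p q t" "t \<in> {..<7}"
    then show ?thesis
      using mirror_config_subset finite_config card_config[OF assms] card_image[OF inj_on_mirror]
      by simp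
  qed
  fix v assume v: "v \<in> {0..<7 * p + 2} \<times> {0..<7 * q + 2}"
  show "\<exists>D'\<in>config p q ` {..<7} \<union> (\<lambda>t. mirror q ` config p q t) ` {..<7}.
      v \<in> D' \<and> guard_move strong_adj D D'"
    using D
  proof (elim UnE imageE)
    fix t :: nat assume t: "D = config p q t" "t \<in> {..<7}"
    obtain u where u: "u < 7" "mirror q v \<in> config p q u"
      using config_cover[OF mirror_in_grid[OF v]] .
    then have "v \<in> mirror q ` config p q u"
      using v by (intro image_eqI[of _ _ "mirror q v"]) (auto simp: mirror_mirror)
    with guard_move_config[OF assms, of t u] t u show ?thesis by auto
  next
    fix t :: nat assume t: "D = mirror q ` config p q t" "t \<in> {..<7}"
    obtain u where "u < 7" "v \<in> config p q u"
      using config_cover[OF v] .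
    with guard_move_sym[OF strong_adj_sym guard_move_config[OF assms, of u t]] t
    show ?thesis by auto
  qed
qed (auto simp: lessThan_empty_iff)

subsection \<open>Completing the grid by cliques\<close>

text \<open>Counting from the corner opposite the core lets \<alpha> columns and \<beta> rows of
  blocks cover the remaining strips.\<close>

definition block :: "nat \<Rightarrow> nat \<Rightarrow> nat \<times> nat \<Rightarrow> nat \<times> nat" where
  "block m n z = ((m - 1 - fst z) div 2, (n - 1 - snd z) div 2)"

lemma block_clique:
  assumes "u \<in> grid_V m n" "v \<in> grid_V m n" "block m n u = block m n v" "u \<noteq> v"
  shows "strong_adj u v"
proof -
  have near: "x \<le> Suc x'" if "x < k" "x' < k" "(k - 1 - x) div 2 = (k - 1 - x') div 2" for x x' k :: nat
    using that by linarith
  show ?thesis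
    using assms near[of "fst u" m "fst v"] near[of "fst v" m "fst u"]
      near[of "snd u" n "snd v"] near[of "snd v" n "snd u"]
    by (cases u; cases v) (auto simp: grid_V_def block_def strong_adj_iff)
qed

text \<open>Outside the core a block has first index below \<alpha> or second index below \<beta>;
  the subtracted product counts the other blocks.\<close>

lemma card_block_image_le:
  assumes "m \<le> b + 2 * \<alpha>" "n \<le> a + 2 * \<beta>"
  shows "card (block m n ` (grid_V m n - {0..<b} \<times> {0..<a}))
    \<le> ((m + 1) div 2) * ((n + 1) div 2) - ((m + 1) div 2 - \<alpha>) * ((n + 1) div 2 - \<beta>)"
proof -
  let ?M = "(m + 1) div 2" and ?N = "(n + 1) div 2"
  have "block m n ` (grid_V m n - {0..<b} \<times> {0..<a})
      \<subseteq> {..<?M} \<times> {..<?N} - {\<alpha>..<?M} \<times> {\<beta>..<?N}"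
  proof (intro image_subsetI)
    fix z assume "z \<in> grid_V m n - {0..<b} \<times> {0..<a}"
    then obtain x y where z: "z = (x, y)" "x < m" "y < n" "b \<le> x \<or> a \<le> y"
      by (cases z) (auto simp: grid_V_def not_less)
    have "(m - 1 - x) div 2 < ?M" "(n - 1 - y) div 2 < ?N"
      using z(2,3) by linarith+
    moreover have "(m - 1 - x) div 2 < \<alpha>" if "b \<le> x"
      using that z(2) assms by linarith
    moreover have "(n - 1 - y) div 2 < \<beta>" if "a \<le> y"
      using that z(3) assms by linarith
    ultimately show "block m n z \<in> {..<?M} \<times> {..<?N} - {\<alpha>..<?M} \<times> {\<beta>..<?N}"
      using z(4) by (auto simp: z(1) block_def)
  qed
  then have "card (block m n ` (grid_V m n - {0..<b} \<times> {0..<a}))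
      \<le> card ({..<?M} \<times> {..<?N} - {\<alpha>..<?M} \<times> {\<beta>..<?N})"
    by (intro card_mono) auto
  also have "\<dots> = ?M * ?N - (?M - \<alpha>) * (?N - \<beta>)"
    by (subst card_Diff_subset) auto
  finally show ?thesis .
qed

section \<open>Arithmetic of the bound\<close>

lemma Greatest_mod:
  fixes n r d :: nat
  assumes "r < d" "r \<le> n"
  shows "(GREATEST a. a \<le> n \<and> a mod d = r) = d * ((n - r) div d) + r"
proof (rule Greatest_equality)
  have "d * ((n - r) div d) \<le> n - r" by simp
  then have "d * ((n - r) div d) + r \<le> n" using assms(2) by linarith
  then show "d * ((n - r) div d) + r \<le> n \<and> (d * ((n - r) div d) + r) mod d = r"
    using assms(1) by simp
next
  fix a assume a: "a \<le> n \<and> a mod d = r"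
  then have split: "a = d * (a div d) + r" by (metis mult_div_mod_eq)
  with a have "d * (a div d) \<le> n - r" by linarith
  then have "a div d \<le> (n - r) div d"
    using assms(1) by (simp add: less_eq_div_iff_mult_less_eq mult.commute)
  then show "a \<le> d * ((n - r) div d) + r"
    by (subst split) simp
qed

lemma ceiling_half: "\<lceil>real n / 2\<rceil> = int ((n + 1) div 2)"
  by linarith

theorem theorem3:
  fixes m n :: nat
  assumes "n \<ge> 9" and "m \<ge> 9"
  defines "a \<equiv> GREATEST a::nat. a \<le> n \<and> a mod 7 = 2"
      and "b \<equiv> GREATEST b::nat. b \<le> m \<and> b mod 7 = 2"
      and "\<alpha> \<equiv> (if m mod 7 = 2 then 0::nat else if m mod 7 \<in> {3,4} then 1
                 else if m mod 7 \<in> {5,6} then 2 else 3)"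
      and "\<beta> \<equiv> (if n mod 7 = 2 then 0::nat else if n mod 7 \<in> {3,4} then 1
                 else if n mod 7 \<in> {5,6} then 2 else 3)"
  shows "real (eternal_dom_all_number (grid_V m n) strong_adj)
           \<le> real (a * b) / 7 + 8 / 7 * (real a + real b - 1)
              + real \<alpha> * real_of_int \<lceil>real n / 2\<rceil>
              + real \<beta> * real_of_int \<lceil>real m / 2\<rceil>
              - real \<alpha> * real \<beta>"
proof -
  \<comment> \<open>With \<open>r = (k - 2) mod 7\<close>, the constant \<open>c\<close> is
    \<open>r / 2\<close> rounded up, so \<open>c\<close> layers of width 2 cover the excess.\<close>
  have pad: "k \<le> 7 * ((k - 2) div 7) + 2 + 2 * c" "2 * c \<le> k"
    if "c = (if k mod 7 = 2 then 0::nat else if k mod 7 \<in> {3,4} then 1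
                 else if k mod 7 \<in> {5,6} then 2 else 3)" "k \<ge> 9" for k c :: nat
  proof -
    have k: "k = 7 * ((k - 2) div 7) + 2 + (k - 2) mod 7"
      using that(2) div_mult_mod_eq[of "k - 2" 7] by linarith
    then have "k mod 7 = (2 + (k - 2) mod 7) mod 7"
      by (metis add.assoc mod_mult_self4)
    moreover have "(k - 2) mod 7 < 7" by simp
    then have "(k - 2) mod 7 = 0 \<or> (k - 2) mod 7 = 1 \<or> (k - 2) mod 7 = 2 \<or> (k - 2) mod 7 = 3 \<or>
        (k - 2) mod 7 = 4 \<or> (k - 2) mod 7 = 5 \<or> (k - 2) mod 7 = 6"
      by linarith
    ultimately have "(k - 2) mod 7 \<le> 2 * c"
      using that(1) by (elim disjE) simp_all
    with k show "k \<le> 7 * ((k - 2) div 7) + 2 + 2 * c" by linarith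
    show "2 * c \<le> k" using that by auto
  qed
  define p q where "p = (m - 2) div 7" and "q = (n - 2) div 7"
  have b: "b = 7 * p + 2" and a: "a = 7 * q + 2"
    using Greatest_mod[of 2 7 m] Greatest_mod[of 2 7 n] assms(1,2)
    by (auto simp: a_def b_def p_def q_def)
  have pq: "p \<ge> 1" "q \<ge> 1" "b \<le> m" "a \<le> n"
    using assms(1,2) by (auto simp: a b p_def q_def)
  have \<alpha>: "m \<le> b + 2 * \<alpha>" "2 * \<alpha> \<le> m" and \<beta>: "n \<le> a + 2 * \<beta>" "2 * \<beta> \<le> n"
    using pad[OF \<alpha>_def[THEN meta_eq_to_obj_eq] assms(2)] pad[OF \<beta>_def[THEN meta_eq_to_obj_eq] assms(1)]
    by (simp_all add: a b p_def q_def)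
  define M N where "M = (m + 1) div 2" and "N = (n + 1) div 2"
  define core rest where "core = {0..<b} \<times> {0..<a}" and "rest = grid_V m n - core"
  have "eternal_dom_all core strong_adj (7 * p * q + 10 * p + 10 * q + 4)"
    using eternal_dom_all_core[OF pq(1,2)] by (simp add: core_def a b)
  moreover have "eternal_dom_all rest strong_adj (card (block m n ` rest))"
    by (rule eternal_dom_all_clique_partition) (auto simp: rest_def grid_V_def intro: block_clique)
  ultimately have "eternal_dom_all (core \<union> rest) strong_adj
      (7 * p * q + 10 * p + 10 * q + 4 + card (block m n ` rest))"
    by (rule eternal_dom_all_Un) (auto simp: rest_def)
  moreover have "core \<union> rest = grid_V m n"
    using pq by (auto simp: core_def rest_def grid_V_def)
  ultimately have "eternal_dom_all_number (grid_V m n) strong_adj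
      \<le> 7 * p * q + 10 * p + 10 * q + 4 + card (block m n ` rest)"
    unfolding eternal_dom_all_number_def by (simp add: Least_le)
  also have "card (block m n ` rest) \<le> M * N - (M - \<alpha>) * (N - \<beta>)"
    using card_block_image_le[OF \<alpha>(1) \<beta>(1)]
    by (simp add: rest_def core_def M_def N_def)
  finally have "real (eternal_dom_all_number (grid_V m n) strong_adj)
      \<le> real (7 * p * q + 10 * p + 10 * q + 4 + (M * N - (M - \<alpha>) * (N - \<beta>)))"
    by (simp only: of_nat_le_iff add_left_mono)
  also have "\<dots> = 7 * real p * real q + 10 * real p + 10 * real q + 4
      + (real M * real N - (real M - real \<alpha>) * (real N - real \<beta>))"
  proof -
    \<comment> \<open>This makes the truncated differences agree with the real ones.\<close>
    have "\<alpha> \<le> M" "\<beta> \<le> N" using \<alpha> \<beta> by (auto simp: M_def N_def)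
    then have "real (M * N - (M - \<alpha>) * (N - \<beta>))
        = real M * real N - (real M - real \<alpha>) * (real N - real \<beta>)"
      by (simp add: of_nat_diff mult_le_mono)
    then show ?thesis
      unfolding of_nat_add by simp
  qed
  \<comment> \<open>Here \<open>a * b / 7\<close> gives \<open>7pq + 2p + 2q + 4/7\<close>, and the
    perimeter term gives \<open>8p + 8q + 24/7\<close>.\<close>
  also have "\<dots> = real (a * b) / 7 + 8 / 7 * (real a + real b - 1)
      + real \<alpha> * real N + real \<beta> * real M - real \<alpha> * real \<beta>"
    by (simp add: a b field_simps)
  finally show ?thesis
    by (simp add: ceiling_half M_def N_def)
qed

end
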